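(* For all integers $m,n\ge1$ and all $\lambda\in\mathbb{C}$ with $\lambda\neq0$ and $\lambda^m\neq1$, \[ H_{n-1}^{(n)}(x|\lambda)=\left(\frac{1-\lambda}{1-\lambda^m}\right)^n\lambda^{mn}\sum_{s=0}^{n-1}\sum_{k=0}^{s}\binom{s}{k}\binom{n-1}{s}(-n)^{s-k}m^{n-1-s}\,S_k^{(n)}(m|\lambda)\,H_{n-1-s}^{(n)}\!\left(\frac{x}{m}\,\middle|\,\lambda^m\right). \]
   Context: For $\mu\in\mathbb{C}$, $\mu\neq1$, the higher-order Frobenius–Euler polynomials are defined by $\left(\frac{1-\mu}{e^t-\mu}\right)^{n}e^{xt}=\sum_{j\ge0}H_j^{(n)}(x|\mu)\frac{t^j}{j!}$. For integers $n\ge0$, $m\ge1$, $k\ge0$ and $\lambda\ne0$, the $\lambda$-analogue of the multiple power sum is \[S_k^{(n)}(m|\lambda)=\sum_{\substack{0\le v_1,\dots,v_m\le n\\ v_1+\cdots+v_m=n}}\binom{n}{v_1,\dots,v_m}\lambda^{-(v_1+2v_2+\cdots+mv_m)}(v_1+2v_2+\cdots+mv_m)^k,\] with $\binom{n}{v_1,\dots,v_m}$ the multinomial coefficient. *)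

theory Defs
  imports
    Complex_Main
    "HOL-Library.FuncSet"
    "HOL-Computational_Algebra.Formal_Power_Series"
begin

(* For \<mu> \<noteq> 1 the denominator has the nonzero constant term 1 - \<mu>, so the quotient is the
   genuine quotient of power series in t; for \<mu> = 1 the value is not meaningful. *)
definition frobenius_euler_fps :: "nat \<Rightarrow> complex \<Rightarrow> complex \<Rightarrow> complex fps" where
  "frobenius_euler_fps n x \<mu> =
     (fps_const (1 - \<mu>) / (fps_exp 1 - fps_const \<mu>)) ^ n * fps_exp x"

definition frobenius_euler :: "nat \<Rightarrow> nat \<Rightarrow> complex \<Rightarrow> complex \<Rightarrow> complex" where
  "frobenius_euler n j x \<mu> = fact j * fps_nth (frobenius_euler_fps n x \<mu>) j"

lemma frobenius_euler_generating_function: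
  "Abs_fps (\<lambda>j. frobenius_euler n j x \<mu> / fact j) = frobenius_euler_fps n x \<mu>"
  by (rule fps_ext) (simp add: frobenius_euler_def)

lemma frobenius_euler_fps_base:
  fixes \<mu> :: complex
  assumes "\<mu> \<noteq> 1"
  shows "(fps_const (1 - \<mu>) / (fps_exp 1 - fps_const \<mu>)) * (fps_exp 1 - fps_const \<mu>)
           = fps_const (1 - \<mu>)"
proof -
  have "is_unit (fps_exp 1 - fps_const \<mu>)"
    using assms by (simp add: fps_is_unit_iff)
  then show ?thesis
    by (rule unit_div_mult_self)
qed

definition multinomial :: "nat \<Rightarrow> nat \<Rightarrow> (nat \<Rightarrow> nat) \<Rightarrow> complex" where
  "multinomial n m v = fact n / (\<Prod>i\<in>{1..m}. fact (v i))"

(* Tuples (v_1, ..., v_m) are represented by extensional functions on {1..m}. *)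
definition multiple_power_sum :: "nat \<Rightarrow> nat \<Rightarrow> nat \<Rightarrow> complex \<Rightarrow> complex" where
  "multiple_power_sum n k m l =
     (\<Sum>v | v \<in> {1..m} \<rightarrow>\<^sub>E {0..n} \<and> (\<Sum>i\<in>{1..m}. v i) = n.
        multinomial n m v * l powi (- int (\<Sum>i\<in>{1..m}. i * v i))
          * of_nat (\<Sum>i\<in>{1..m}. i * v i) ^ k)"

end

theory Submission
  imports Defs
begin

text \<open>
  Let \<open>B\<^sub>\<mu> = (1 - \<mu>) / (e\<^sup>t - \<mu>)\<close> and \<open>q = l\<^sup>-\<^sup>1 e\<^sup>t\<close>. Summing the geometric series \<open>P = q + \<dots> + q\<^sup>m\<close>
  gives \<open>l\<^sup>m P (e\<^sup>t - l) = e\<^sup>t (e\<^sup>m\<^sup>t - l\<^sup>m)\<close>, so \<open>B\<^sub>l(t)\<close> is a constant multiple of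
  \<open>P e\<^sup>-\<^sup>t B\<^sub>\<mu>(m t)\<close> with \<open>\<mu> = l\<^sup>m\<close>. Raise this to the power \<open>n\<close> and multiply by \<open>e\<^sup>x\<^sup>t\<close>. By the multinomial
  theorem \<open>P\<^sup>n\<close> is the exponential generating function of the multiple power sums, and comparing
  the coefficients of any power of \<open>t\<close>, not only of \<open>t\<^sup>n\<^sup>-\<^sup>1\<close>, gives the identity.
\<close>

subsection \<open>The multinomial theorem\<close>

definition weak_compositions :: "'a set \<Rightarrow> nat \<Rightarrow> ('a \<Rightarrow> nat) set" where
  "weak_compositions A n = {v \<in> A \<rightarrow>\<^sub>E UNIV. (\<Sum>i\<in>A. v i) = n}"

definition multinomial_coeff :: "'a set \<Rightarrow> ('a \<Rightarrow> nat) \<Rightarrow> nat" where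
  "multinomial_coeff A v = fact (\<Sum>i\<in>A. v i) div (\<Prod>i\<in>A. fact (v i))"

lemma weak_compositions_empty:
  "weak_compositions {} n = (if n = 0 then {\<lambda>_. undefined} else {})"
  by (auto simp: weak_compositions_def)

lemma weak_compositions_eq_bounded:
  assumes "finite A"
  shows "weak_compositions A n = {v \<in> A \<rightarrow>\<^sub>E {0..n}. (\<Sum>i\<in>A. v i) = n}"
  using assms by (auto simp: weak_compositions_def PiE_iff intro: member_le_sum)

lemma finite_weak_compositions:
  assumes "finite A"
  shows "finite (weak_compositions A n)"
  unfolding weak_compositions_eq_bounded[OF assms]
  using finite_PiE[OF assms, of "\<lambda>_. {0..n}"] by simp

lemma sum_weak_compositions_insert:
  assumes "finite A" and "x \<notin> A"
  shows "(\<Sum>v\<in>weak_compositions (insert x A) n. h v) =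
    (\<Sum>k\<le>n. \<Sum>v\<in>weak_compositions A (n - k). h (v(x := k)))"
proof -
  have sum_fun_upd: "(\<Sum>i\<in>A. if i = x then k else v i) = (\<Sum>i\<in>A. v i)" for v :: "'a \<Rightarrow> nat" and k
    using assms(2) by (intro sum.cong) auto
  have "v x \<le> n" if "v \<in> weak_compositions (insert x A) n" for v
    using that assms by (auto simp: weak_compositions_def)
  then have "(\<Sum>v\<in>weak_compositions (insert x A) n. h v) =
      (\<Sum>k\<le>n. \<Sum>v | v \<in> weak_compositions (insert x A) n \<and> v x = k. h v)"
    using assms(1) by (intro sum.group[symmetric]) (auto intro: finite_weak_compositions)
  also have "\<dots> = (\<Sum>k\<le>n. \<Sum>v\<in>weak_compositions A (n - k). h (v(x := k)))"
  proof (rule sum.cong[OF refl])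
    fix k assume "k \<in> {..n}"
    then show "(\<Sum>v | v \<in> weak_compositions (insert x A) n \<and> v x = k. h v) =
        (\<Sum>v\<in>weak_compositions A (n - k). h (v(x := k)))"
      using assms
      by (intro sum.reindex_bij_witness[where i = "\<lambda>v. v(x := k)" and j = "\<lambda>v. v(x := undefined)"])
        (auto simp: weak_compositions_def PiE_def extensional_def sum_fun_upd)
  qed
  finally show ?thesis .
qed

lemma prod_fact_dvd_fact_sum:
  fixes v :: "'a \<Rightarrow> nat"
  assumes "finite A"
  shows "(\<Prod>i\<in>A. fact (v i)) dvd (fact (\<Sum>i\<in>A. v i) :: nat)"
  using assms
proof induction
  case empty
  then show ?case by simp
next
  case (insert x A)
  have "fact (v x) * (\<Prod>i\<in>A. fact (v i)) dvd (fact (v x) * fact (\<Sum>i\<in>A. v i) :: nat)"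
    using insert.IH by (rule mult_dvd_mono[OF dvd_refl])
  also have "\<dots> dvd fact (v x + (\<Sum>i\<in>A. v i))"
    by (rule fact_fact_dvd_fact)
  finally show ?case
    using insert.hyps by simp
qed

lemma multinomial_coeff_mult_prod_fact:
  assumes "finite A"
  shows "multinomial_coeff A v * (\<Prod>i\<in>A. fact (v i)) = fact (\<Sum>i\<in>A. v i)"
  unfolding multinomial_coeff_def using prod_fact_dvd_fact_sum[OF assms] by simp

lemma of_nat_multinomial_coeff:
  assumes "finite A"
  shows "(of_nat (multinomial_coeff A v) :: 'b::field_char_0) =
    fact (\<Sum>i\<in>A. v i) / (\<Prod>i\<in>A. fact (v i))"
proof -
  have "of_nat (multinomial_coeff A v) * (\<Prod>i\<in>A. fact (v i)) = (fact (\<Sum>i\<in>A. v i) :: 'b)"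
    using arg_cong[OF multinomial_coeff_mult_prod_fact[OF assms], of "of_nat :: nat \<Rightarrow> 'b"]
    by (simp only: of_nat_mult of_nat_prod of_nat_fact)
  then show ?thesis
    using assms by (simp add: eq_divide_eq)
qed

lemma multinomial_coeff_insert:
  assumes "finite A" and "x \<notin> A"
  shows "multinomial_coeff (insert x A) v =
    (v x + (\<Sum>i\<in>A. v i) choose v x) * multinomial_coeff A v"
proof -
  let ?prod_fact = "\<Prod>i\<in>A. fact (v i) :: nat"
  have "multinomial_coeff (insert x A) v * (fact (v x) * ?prod_fact) = fact (v x + (\<Sum>i\<in>A. v i))"
    using multinomial_coeff_mult_prod_fact[of "insert x A" v] assms by simp
  also have "\<dots> = fact (v x) * fact (\<Sum>i\<in>A. v i) * (v x + (\<Sum>i\<in>A. v i) choose v x)"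
    using binomial_fact_lemma[of "v x" "v x + (\<Sum>i\<in>A. v i)"] by simp
  also have "\<dots> = (v x + (\<Sum>i\<in>A. v i) choose v x) * multinomial_coeff A v * (fact (v x) * ?prod_fact)"
    unfolding multinomial_coeff_mult_prod_fact[OF assms(1), symmetric] by (simp only: mult_ac)
  finally show ?thesis
    using assms(1) by simp
qed

theorem multinomial_theorem:
  fixes f :: "'a \<Rightarrow> 'b::comm_semiring_1"
  assumes "finite A"
  shows "(\<Sum>i\<in>A. f i) ^ n =
    (\<Sum>v\<in>weak_compositions A n. of_nat (multinomial_coeff A v) * (\<Prod>i\<in>A. f i ^ v i))"
  using assms
proof (induction A arbitrary: n)
  case empty
  then show ?case
    by (simp add: weak_compositions_empty multinomial_coeff_def power_0_left)
next
  case (insert x A)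
  let ?monomial = "\<lambda>A v. of_nat (multinomial_coeff A v) * (\<Prod>i\<in>A. f i ^ v i)"
  have monomial_insert: "of_nat (n choose k) * f x ^ k * ?monomial A v =
      ?monomial (insert x A) (v(x := k))"
    if "k \<le> n" and "v \<in> weak_compositions A (n - k)" for k v
  proof -
    let ?w = "v(x := k)"
    have agree: "?w i = v i" if "i \<in> A" for i
      using that insert.hyps by auto
    have "(\<Sum>i\<in>A. ?w i) = n - k" and "multinomial_coeff A ?w = multinomial_coeff A v"
      using that(2) agree by (simp_all add: weak_compositions_def multinomial_coeff_def)
    then have "multinomial_coeff (insert x A) ?w = (n choose k) * multinomial_coeff A v"
      unfolding multinomial_coeff_insert[OF insert.hyps] using that(1) by simp
    moreover have "(\<Prod>i\<in>insert x A. f i ^ ?w i) = f x ^ k * (\<Prod>i\<in>A. f i ^ v i)"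
      using insert.hyps agree by simp
    ultimately show ?thesis
      by (simp only: of_nat_mult mult_ac)
  qed
  have "(\<Sum>i\<in>insert x A. f i) ^ n = (f x + (\<Sum>i\<in>A. f i)) ^ n"
    using insert.hyps by simp
  also have "\<dots> = (\<Sum>k\<le>n. \<Sum>v\<in>weak_compositions A (n - k).
      of_nat (n choose k) * f x ^ k * ?monomial A v)"
    unfolding binomial_ring insert.IH sum_distrib_left ..
  also have "\<dots> = (\<Sum>v\<in>weak_compositions (insert x A) n. ?monomial (insert x A) v)"
    unfolding sum_weak_compositions_insert[OF insert.hyps]
    by (intro sum.cong refl monomial_insert) auto
  finally show ?case .
qed

corollary sum_powers_power:
  fixes q :: "'b::comm_semiring_1" and d :: "'a \<Rightarrow> nat"
  assumes "finite A"
  shows "(\<Sum>i\<in>A. q ^ d i) ^ n =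
    (\<Sum>v\<in>weak_compositions A n. of_nat (multinomial_coeff A v) * q ^ (\<Sum>i\<in>A. d i * v i))"
  unfolding multinomial_theorem[OF assms] by (simp only: power_mult power_sum)

subsection \<open>Sums of exponentials\<close>

definition exp_geometric_sum :: "nat \<Rightarrow> 'a \<Rightarrow> 'a::field_char_0 fps" where
  "exp_geometric_sum m l = (\<Sum>i=1..m. (fps_const (inverse l) * fps_exp 1) ^ i)"

lemma exp_geometric_sum_mult:
  assumes "l \<noteq> 0"
  shows "fps_const (l ^ m) * exp_geometric_sum m l * (fps_exp 1 - fps_const l) =
    fps_exp 1 * (fps_exp (of_nat m) - fps_const (l ^ m))"
proof -
  let ?q = "fps_const (inverse l) * fps_exp 1"
  have const_mult_q: "fps_const l * ?q = fps_exp 1"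
    using assms by (simp add: mult.assoc[symmetric])
  have const_mult_q_power: "fps_const (l ^ m) * ?q ^ m = fps_exp (of_nat m)"
    unfolding fps_const_power[symmetric] power_mult_distrib[symmetric] const_mult_q
    by (simp add: fps_exp_power_mult)
  have geometric: "exp_geometric_sum m l * (?q - 1) = ?q * (?q ^ m - 1)"
  proof (cases "m = 0")
    case False
    then show ?thesis
      using sum_gp_multiplied[of 1 m ?q] by (simp add: exp_geometric_sum_def algebra_simps)
  qed (simp add: exp_geometric_sum_def)
  have "fps_exp 1 - fps_const l = fps_const l * (?q - 1)"
    unfolding right_diff_distrib const_mult_q by simp
  then have "fps_const (l ^ m) * exp_geometric_sum m l * (fps_exp 1 - fps_const l) =
      fps_const (l ^ m) * fps_const l * (exp_geometric_sum m l * (?q - 1))"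
    by (simp only: mult_ac)
  also have "\<dots> = (fps_const l * ?q) * (fps_const (l ^ m) * ?q ^ m - fps_const (l ^ m))"
    unfolding geometric by (simp only: right_diff_distrib mult_1_left mult_1_right mult_ac)
  finally show ?thesis
    unfolding const_mult_q const_mult_q_power .
qed

lemma multiple_power_sum_eq_sum_weak_compositions:
  "multiple_power_sum n k m l = (\<Sum>v\<in>weak_compositions {1..m} n.
    of_nat (multinomial_coeff {1..m} v) *
      (inverse l ^ (\<Sum>i=1..m. i * v i) * of_nat (\<Sum>i=1..m. i * v i) ^ k))"
  unfolding multiple_power_sum_def weak_compositions_eq_bounded[OF finite_atLeastAtMost]
  by (intro sum.cong refl)
    (auto simp: multinomial_def of_nat_multinomial_coeff power_int_minus power_inverse
      simp del: of_nat_sum)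

lemma exp_geometric_sum_power_nth:
  "fps_nth (exp_geometric_sum m l ^ n) k = multiple_power_sum n k m l / fact k"
proof -
  have "fps_nth (of_nat c * (fps_const (inverse l) * fps_exp 1) ^ w) k =
      of_nat c * (inverse l ^ w * of_nat w ^ k) / fact k" for c w
    by (simp add: power_mult_distrib fps_exp_power_mult fps_of_nat[symmetric])
  then show ?thesis
    unfolding exp_geometric_sum_def sum_powers_power[OF finite_atLeastAtMost]
      multiple_power_sum_eq_sum_weak_compositions
    by (simp only: fps_sum_nth sum_divide_distrib)
qed

subsection \<open>The multiplication formula\<close>

definition frobenius_euler_kernel :: "complex \<Rightarrow> complex fps" where
  "frobenius_euler_kernel \<mu> = fps_const (1 - \<mu>) / (fps_exp 1 - fps_const \<mu>)"

lemma frobenius_euler_fps_eq_kernel_power: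
  "frobenius_euler_fps n x \<mu> = frobenius_euler_kernel \<mu> ^ n * fps_exp x"
  by (simp add: frobenius_euler_fps_def frobenius_euler_kernel_def)

lemma frobenius_euler_kernel_compose_linear:
  assumes "\<mu> \<noteq> 1"
  shows "(frobenius_euler_kernel \<mu> oo (fps_const c * fps_X)) * (fps_exp c - fps_const \<mu>) =
    fps_const (1 - \<mu>)"
proof -
  let ?cX = "fps_const c * fps_X"
  have "(frobenius_euler_kernel \<mu> oo ?cX) * (fps_exp c - fps_const \<mu>) =
      (frobenius_euler_kernel \<mu> * (fps_exp 1 - fps_const \<mu>)) oo ?cX"
    by (simp add: fps_compose_mult_distrib fps_compose_sub_distrib)
  then show ?thesis
    unfolding frobenius_euler_kernel_def frobenius_euler_fps_base[OF assms] by simp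
qed

lemma frobenius_euler_kernel_dilation:
  assumes "l \<noteq> 0" and "l ^ m \<noteq> 1"
  shows "frobenius_euler_kernel l = fps_const ((1 - l) / (1 - l ^ m) * l ^ m) *
    (exp_geometric_sum m l * fps_exp (- 1) *
      (frobenius_euler_kernel (l ^ m) oo (fps_const (of_nat m) * fps_X)))"
    (is "_ = ?rhs")
proof -
  let ?denominator = "fps_exp 1 - fps_const l"
  let ?dilated = "frobenius_euler_kernel (l ^ m) oo (fps_const (of_nat m) * fps_X)"
  have "l \<noteq> 1"
    using assms(2) by auto
  have "?rhs * ?denominator = fps_const ((1 - l) / (1 - l ^ m)) *
      ((fps_const (l ^ m) * exp_geometric_sum m l * ?denominator) * fps_exp (- 1) * ?dilated)"
    unfolding fps_const_mult[symmetric] by (simp only: mult_ac)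
  also have "\<dots> = fps_const ((1 - l) / (1 - l ^ m)) * ((fps_exp 1 * fps_exp (- 1)) *
      (?dilated * (fps_exp (of_nat m) - fps_const (l ^ m))))"
    unfolding exp_geometric_sum_mult[OF assms(1)] by (simp only: mult_ac)
  also have "\<dots> = fps_const (1 - l)"
    unfolding frobenius_euler_kernel_compose_linear[OF assms(2)]
    using assms(2) by (simp add: fps_exp_add_mult[symmetric])
  also have "\<dots> = frobenius_euler_kernel l * ?denominator"
    unfolding frobenius_euler_kernel_def using frobenius_euler_fps_base[OF \<open>l \<noteq> 1\<close>] by simp
  finally have "?rhs * ?denominator = frobenius_euler_kernel l * ?denominator" .
  moreover have "?denominator \<noteq> 0"
    using \<open>l \<noteq> 1\<close> by simp
  ultimately show ?thesis
    by simp
qed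

lemma frobenius_euler_fps_dilation:
  assumes "m \<ge> 1" and "l \<noteq> 0" and "l ^ m \<noteq> 1"
  shows "frobenius_euler_fps n x l =
    fps_const (((1 - l) / (1 - l ^ m)) ^ n * l ^ (m * n)) *
    ((exp_geometric_sum m l ^ n * fps_exp (- of_nat n)) *
     (frobenius_euler_fps n (x / of_nat m) (l ^ m) oo (fps_const (of_nat m) * fps_X)))"
proof -
  let ?mX = "fps_const (of_nat m :: complex) * fps_X"
  have "frobenius_euler_fps n (x / of_nat m) (l ^ m) oo ?mX =
      (frobenius_euler_kernel (l ^ m) oo ?mX) ^ n * fps_exp x"
    using \<open>m \<ge> 1\<close>
    by (simp add: frobenius_euler_fps_eq_kernel_power fps_compose_mult_distrib fps_compose_power)
  moreover have "fps_exp (- of_nat n) = (fps_exp (- 1) :: complex fps) ^ n"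
    by (simp add: fps_exp_power_mult)
  moreover have "((1 - l) / (1 - l ^ m)) ^ n * l ^ (m * n) = ((1 - l) / (1 - l ^ m) * l ^ m) ^ n"
    by (simp only: power_mult_distrib power_mult)
  ultimately show ?thesis
    unfolding frobenius_euler_fps_eq_kernel_power[of n x l]
      frobenius_euler_kernel_dilation[OF assms(2,3)]
    by (simp only: power_mult_distrib fps_const_power mult_ac)
qed

lemma fact_mult_fps_mult_nth:
  fixes f g :: "'a::field_char_0 fps"
  shows "fact N * fps_nth (f * g) N =
    (\<Sum>s=0..N. of_nat (N choose s) * (fact s * fps_nth f s) * (fact (N - s) * fps_nth g (N - s)))"
  by (simp add: fps_mult_nth sum_distrib_left binomial_fact)

theorem frobenius_euler_multiplication:
  assumes "m \<ge> 1" and "l \<noteq> 0" and "l ^ m \<noteq> 1"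
  shows "frobenius_euler n N x l =
    ((1 - l) / (1 - l ^ m)) ^ n * l ^ (m * n) *
      (\<Sum>s = 0..N. \<Sum>k = 0..s.
         of_nat (s choose k) * of_nat (N choose s) * (- of_nat n) ^ (s - k)
           * of_nat m ^ (N - s) * multiple_power_sum n k m l
           * frobenius_euler n (N - s) (x / of_nat m) (l ^ m))"
proof -
  let ?const = "((1 - l) / (1 - l ^ m)) ^ n * l ^ (m * n)"
  let ?sums = "exp_geometric_sum m l ^ n * fps_exp (- of_nat n)"
  let ?dilated = "frobenius_euler_fps n (x / of_nat m) (l ^ m) oo (fps_const (of_nat m) * fps_X)"
  have sums_nth: "fact s * fps_nth ?sums s =
      (\<Sum>k=0..s. of_nat (s choose k) * multiple_power_sum n k m l * (- of_nat n) ^ (s - k))" for s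
    unfolding fact_mult_fps_mult_nth by (simp add: exp_geometric_sum_power_nth)
  have dilated_nth: "fact j * fps_nth ?dilated j =
      of_nat m ^ j * frobenius_euler n j (x / of_nat m) (l ^ m)" for j
    by (simp add: frobenius_euler_def)
  have "frobenius_euler n N x l = ?const * (fact N * fps_nth (?sums * ?dilated) N)"
    unfolding frobenius_euler_def frobenius_euler_fps_dilation[OF assms] fps_mult_left_const_nth
    by (simp only: mult_ac)
  also have "fact N * fps_nth (?sums * ?dilated) N =
      (\<Sum>s=0..N. of_nat (N choose s) *
        (\<Sum>k=0..s. of_nat (s choose k) * multiple_power_sum n k m l * (- of_nat n) ^ (s - k)) *
        (of_nat m ^ (N - s) * frobenius_euler n (N - s) (x / of_nat m) (l ^ m)))"
    unfolding fact_mult_fps_mult_nth[of N ?sums ?dilated] sums_nth dilated_nth ..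
  finally show ?thesis
    by (simp only: sum_distrib_left sum_distrib_right mult_ac)
qed

theorem theorem5:
  fixes m n :: nat and x l :: complex
  assumes "m \<ge> 1" and "n \<ge> 1" and "l \<noteq> 0" and "l ^ m \<noteq> 1"
  shows "frobenius_euler n (n - 1) x l =
    ((1 - l) / (1 - l ^ m)) ^ n * l ^ (m * n) *
      (\<Sum>s = 0..n - 1. \<Sum>k = 0..s.
         of_nat (s choose k) * of_nat ((n - 1) choose s) * (- of_nat n) ^ (s - k)
           * of_nat m ^ (n - 1 - s) * multiple_power_sum n k m l
           * frobenius_euler n (n - 1 - s) (x / of_nat m) (l ^ m))"
  using assms(1,3,4) by (rule frobenius_euler_multiplication)

end
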